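(* Let the moment-based ambiguity sets $\mathcal F_0,\mathcal F_1,\dots,\mathcal F_K$ and the product ambiguity set $\mathcal F=\mathcal F_1\times\cdots\times\mathcal F_K$ be as defined in the context. Then the joint distributionally robust chance constrained Markov decision problem $$\max_{\tau}\ \inf_{F_0\in\mathcal F_0}\ \frac{1}{1-\alpha}\mathbb E_{F_0}[\tau^\top r_0]\quad\text{s.t.}\quad \inf_{F\in\mathcal F}\mathbb P_F\big(\tau^\top r_k\ge \xi_k,\ k=1,\dots,K\big)\ge\hat\epsilon,\qquad \tau\in\Delta_{\alpha,q},$$ can be reformulated as $$\min_{\tau\in\mathbb R_+^{|\Lambda|},\,h\in\mathbb R_+^K}\ \frac1{1-\alpha}\Big[-\tau^\top\mu_0+\sqrt{\rho_{1,0}}\,\big\|\Sigma_0^{1/2}\tau\big\|\Big]$$ subject to $$\tau^\top\mu_k-\Big(\sqrt{\tfrac{h_k}{1-h_k}}\sqrt{\rho_{2,k}}+\sqrt{\rho_{1,k}}\Big)\big\|\Sigma_k^{1/2}\tau\big\|\ge\xi_k,\quad k=1,\dots,K,$$ $$0\le h_k\le1,\quad k=1,\dots,K,\qquad \prod_{k=1}^K h_k\ge\hat\epsilon,\qquad \tau\in\Delta_{\alpha,q}.$$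
   Context: Markov decision data: $\mathcal S$ is a finite state space; for each $s\in\mathcal S$, $\mathcal A(s)$ is a finite set of actions; $\Lambda=\{(s,a): s\in\mathcal S,\ a\in\mathcal A(s)\}$; $p(s'|s,a)$ are transition probabilities; $q=(q(s))_{s\in\mathcal S}$ is the initial probability distribution; $\alpha\in[0,1)$ is the discount factor. Vectors in $\mathbb R^{|\Lambda|}$ are indexed by $\Lambda$. With $\delta$ the Kronecker delta, $$\Delta_{\alpha,q}=\Big\{\tau\in\mathbb R^{|\Lambda|}:\ \tau\ge0,\ \sum_{(s,a)\in\Lambda}\tau(s,a)\big(\delta(s',s)-\alpha p(s'|s,a)\big)=(1-\alpha)q(s')\ \ \forall s'\in\mathcal S\Big\}.$$ $r_0,r_1,\dots,r_K$ are random vectors in $\mathbb R^{|\Lambda|}$ (rewards), $\xi_1,\dots,\xi_K\in\mathbb R$ are given bounds, and $\hat\epsilon\in[0,1]$ is a given confidence level. Ambiguity sets: for $k=0,1,\dots,K$ let $\mu_k\in\mathbb R^{|\Lambda|}$, let $\Sigma_k\in\mathbb R^{|\Lambda|\times|\Lambda|}$ be a symmetric positive semidefinite, invertible matrix, and let $\rho_{1,k},\rho_{2,k}\ge0$. Then $\mathcal F_k$ is the set of probability distributions $F_k$ of $r_k$ on $\mathbb R^{|\Lambda|}$ such that $$(\mathbb E_{F_k}[r_k]-\mu_k)^\top\Sigma_k^{-1}(\mathbb E_{F_k}[r_k]-\mu_k)\le\rho_{1,k},\qquad \mathrm{Cov}_{F_k}[r_k]\preceq\rho_{2,k}\Sigma_k,$$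 where $\mathrm{Cov}_{F_k}[r_k]$ is the covariance matrix of $r_k$ under $F_k$ and $A\preceq B$ means that $B-A$ is positive semidefinite. The joint ambiguity set is $$\mathcal F=\{F=F_1\times\cdots\times F_K:\ F_k\in\mathcal F_k,\ k=1,\dots,K\},$$ i.e. the joint distribution $F$ of $(r_1,\dots,r_K)$ has independent marginals $F_k\in\mathcal F_k$. $\|\cdot\|$ is the Euclidean norm, and $\sqrt{h_k/(1-h_k)}$ is read as $+\infty$ for $h_k=1$ (with $0\cdot\infty=0$). "Can be reformulated as" means equivalence of the two optimization problems: $\tau$ is feasible for the first problem if and only if there is an $h$ such that $(\tau,h)$ is feasible for the second, and the objective of the second problem at such a $(\tau,h)$ is minus the objective of the first problem at $\tau$.
   Formalization: The implication from feasibility of τ for the first problem to existence of h is stated only for ε̂ > 0, since at ε̂ = 0 the chance constraint is vacuous while the second problem still constrains τ; the converse and the objective identity cover all ε̂ in [0,1]. *)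

theory Defs
  imports "HOL-Probability.Probability"
begin

definition state_actions :: "('s \<Rightarrow> 'a set) \<Rightarrow> ('s \<times> 'a) set" where
  "state_actions A = (SIGMA s:UNIV. A s)"

text \<open>
  Vectors indexed by the state-action pairs are rendered as elements of \<open>real ^ 'l\<close>, where
  \<open>ix\<close> is a bijection from the set of state-action pairs onto the index type \<open>'l\<close>; the coordinate
  \<open>v(s,a)\<close> is \<open>v $ ix (s, a)\<close>.
\<close>

definition occupation_set ::
  "('s::finite \<Rightarrow> 'a set) \<Rightarrow> ('s \<Rightarrow> 'a \<Rightarrow> 's pmf) \<Rightarrow> 's pmf \<Rightarrow> real \<Rightarrow> ('s \<times> 'a \<Rightarrow> 'l::finite)
    \<Rightarrow> (real ^ 'l) set" where
  "occupation_set A p q \<alpha> ix =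
     {\<tau>. (\<forall>l. 0 \<le> \<tau> $ l) \<and>
         (\<forall>s'. (\<Sum>(s, a)\<in>state_actions A.
                  \<tau> $ ix (s, a) * ((if s' = s then 1 else 0) - \<alpha> * pmf (p s a) s'))
               = (1 - \<alpha>) * pmf q s')}"

definition psd :: "real ^ 'n ^ 'n \<Rightarrow> bool" where
  "psd M \<longleftrightarrow> transpose M = M \<and> (\<forall>x. 0 \<le> x \<bullet> (M *v x))"

definition loewner_le :: "real ^ 'n ^ 'n \<Rightarrow> real ^ 'n ^ 'n \<Rightarrow> bool" where
  "loewner_le M N \<longleftrightarrow> psd (N - M)"

text \<open>A positive semidefinite matrix has exactly one positive semidefinite square root.\<close>

definition matrix_sqrt :: "real ^ 'n ^ 'n \<Rightarrow> real ^ 'n ^ 'n" where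
  "matrix_sqrt M = (SOME R. psd R \<and> R ** R = M)"

definition mean_vector :: "(real ^ 'n) measure \<Rightarrow> real ^ 'n" where
  "mean_vector F = (\<integral>x. x \<partial>F)"

definition covariance_matrix :: "(real ^ 'n) measure \<Rightarrow> real ^ 'n ^ 'n" where
  "covariance_matrix F =
     (\<chi> i j. \<integral>x. (x $ i - mean_vector F $ i) * (x $ j - mean_vector F $ j) \<partial>F)"

text \<open>
  Square integrability is what makes the mean and the covariance matrix exist; without it the
  Bochner integrals could silently be \<open>0\<close>.
\<close>

definition ambiguity_set ::
  "real ^ 'n \<Rightarrow> real ^ 'n ^ 'n \<Rightarrow> real \<Rightarrow> real \<Rightarrow> (real ^ 'n) measure set" where
  "ambiguity_set \<mu> \<Sigma> \<rho>1 \<rho>2 =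
     {F. prob_space F \<and> sets F = sets borel \<and> integrable F (\<lambda>x. (norm x)\<^sup>2) \<and>
         (mean_vector F - \<mu>) \<bullet> (matrix_inv \<Sigma> *v (mean_vector F - \<mu>)) \<le> \<rho>1 \<and>
         loewner_le (covariance_matrix F) (\<rho>2 *\<^sub>R \<Sigma>)}"

definition joint_ambiguity_set ::
  "nat \<Rightarrow> (nat \<Rightarrow> real ^ 'n) \<Rightarrow> (nat \<Rightarrow> real ^ 'n ^ 'n) \<Rightarrow> (nat \<Rightarrow> real) \<Rightarrow> (nat \<Rightarrow> real)
    \<Rightarrow> (nat \<Rightarrow> real ^ 'n) measure set" where
  "joint_ambiguity_set K \<mu> \<Sigma> \<rho>1 \<rho>2 =
     {Pi\<^sub>M {1..K} F | F. \<forall>k\<in>{1..K}. F k \<in> ambiguity_set (\<mu> k) (\<Sigma> k) (\<rho>1 k) (\<rho>2 k)}"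

text \<open>
  Infima are taken in the extended reals, where they are meaningful without any
  boundedness or nonemptiness condition.
\<close>

definition dr_objective ::
  "real \<Rightarrow> (nat \<Rightarrow> real ^ 'l) \<Rightarrow> (nat \<Rightarrow> real ^ 'l ^ 'l) \<Rightarrow> (nat \<Rightarrow> real) \<Rightarrow> (nat \<Rightarrow> real)
    \<Rightarrow> real ^ 'l \<Rightarrow> ereal" where
  "dr_objective \<alpha> \<mu> \<Sigma> \<rho>1 \<rho>2 \<tau> =
     (INF F\<in>ambiguity_set (\<mu> 0) (\<Sigma> 0) (\<rho>1 0) (\<rho>2 0).
        ereal (1 / (1 - \<alpha>) * (\<integral>r. \<tau> \<bullet> r \<partial>F)))"

definition dr_feasible ::
  "(real ^ 'l) set \<Rightarrow> nat \<Rightarrow> (nat \<Rightarrow> real ^ 'l) \<Rightarrow> (nat \<Rightarrow> real ^ 'l ^ 'l) \<Rightarrow> (nat \<Rightarrow> real)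
    \<Rightarrow> (nat \<Rightarrow> real) \<Rightarrow> (nat \<Rightarrow> real) \<Rightarrow> real \<Rightarrow> real ^ 'l \<Rightarrow> bool" where
  "dr_feasible D K \<mu> \<Sigma> \<rho>1 \<rho>2 \<xi> \<epsilon> \<tau> \<longleftrightarrow>
     (INF F\<in>joint_ambiguity_set K \<mu> \<Sigma> \<rho>1 \<rho>2.
        ereal (measure F {r \<in> space F. \<forall>k\<in>{1..K}. \<tau> \<bullet> r k \<ge> \<xi> k})) \<ge> ereal \<epsilon> \<and>
     \<tau> \<in> D"

definition sqrt_odds :: "real \<Rightarrow> ereal" where
  "sqrt_odds h = (if h = 1 then \<infinity> else ereal (sqrt (h / (1 - h))))"

definition reform_objective ::
  "real \<Rightarrow> (nat \<Rightarrow> real ^ 'l) \<Rightarrow> (nat \<Rightarrow> real ^ 'l ^ 'l) \<Rightarrow> (nat \<Rightarrow> real) \<Rightarrow> real ^ 'l \<Rightarrow> real" where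
  "reform_objective \<alpha> \<mu> \<Sigma> \<rho>1 \<tau> =
     1 / (1 - \<alpha>) * (- (\<tau> \<bullet> \<mu> 0) + sqrt (\<rho>1 0) * norm (matrix_sqrt (\<Sigma> 0) *v \<tau>))"

text \<open>
  The constraint is evaluated in \<open>ereal\<close>, where \<open>0 * \<infinity> = 0\<close>. Only the values \<open>h 1, \<dots>, h K\<close>
  matter.
\<close>

definition reform_feasible ::
  "(real ^ 'l) set \<Rightarrow> nat \<Rightarrow> (nat \<Rightarrow> real ^ 'l) \<Rightarrow> (nat \<Rightarrow> real ^ 'l ^ 'l) \<Rightarrow> (nat \<Rightarrow> real)
    \<Rightarrow> (nat \<Rightarrow> real) \<Rightarrow> (nat \<Rightarrow> real) \<Rightarrow> real \<Rightarrow> real ^ 'l \<Rightarrow> (nat \<Rightarrow> real) \<Rightarrow> bool" where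
  "reform_feasible D K \<mu> \<Sigma> \<rho>1 \<rho>2 \<xi> \<epsilon> \<tau> h \<longleftrightarrow>
     (\<forall>k\<in>{1..K}.
        ereal (\<tau> \<bullet> \<mu> k)
          - (sqrt_odds (h k) * ereal (sqrt (\<rho>2 k)) + ereal (sqrt (\<rho>1 k)))
            * ereal (norm (matrix_sqrt (\<Sigma> k) *v \<tau>))
        \<ge> ereal (\<xi> k)) \<and>
     (\<forall>k\<in>{1..K}. 0 \<le> h k \<and> h k \<le> 1) \<and>
     (\<Prod>k=1..K. h k) \<ge> \<epsilon> \<and>
     \<tau> \<in> D"

end

theory Submission
  imports Defs
begin

text \<open>
  The product structure of the joint ambiguity set decouples the chance constraint: the worst-case
  joint probability is the product of the worst-case marginal probabilities, and \<open>h k\<close> plays the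
  role of the \<open>k\<close>-th factor. For one constraint, the ellipsoid condition lets the mean of \<open>\<tau> \<bullet> r\<close> drop
  at most to \<open>\<tau> \<bullet> \<mu> - sqrt \<rho>1 * \<parallel>\<Sigma>\<^sup>1\<^sup>/\<^sup>2 \<tau>\<parallel>\<close> (Cauchy--Schwarz), and its variance is at most
  \<open>\<rho>2 * \<parallel>\<Sigma>\<^sup>1\<^sup>/\<^sup>2 \<tau>\<parallel>\<^sup>2\<close>. With \<open>t\<close> the distance of the lowest mean above \<open>\<xi>\<close> and \<open>s\<close> the largest
  standard deviation, Cantelli's inequality gives probability at least \<open>t\<^sup>2 / (s\<^sup>2 + t\<^sup>2)\<close>, which
  two-point laws approach; solving \<open>h \<le> t\<^sup>2 / (s\<^sup>2 + t\<^sup>2)\<close> for \<open>t\<close> produces the factor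
  \<open>sqrt (h / (1 - h))\<close>. The infimum need not be attained (the two-point law at distance exactly \<open>t\<close>
  puts mass on the boundary of the half-space), hence the limits \<open>d \<rightarrow> 0\<close>. The square root of
  \<open>\<Sigma>\<close> comes from an orthonormal eigenbasis, built by maximising the Rayleigh quotient.
\<close>

subsection \<open>Square roots of positive semidefinite matrices\<close>

text \<open>The first-order condition at the minimum \<open>t = 0\<close>, proved without
  derivatives.\<close>

lemma quadratic_nonneg_imp_linear_coeff_zero:
  fixes b c :: real
  assumes "\<And>t. 0 \<le> 2 * t * b + t\<^sup>2 * c"
  shows "b = 0"
proof (rule ccontr)
  assume "b \<noteq> 0"
  \<comment> \<open>A step against the sign of \<open>b\<close>, short enough for the linear term to
    beat the quadratic one; the \<open>+ 1\<close> keeps the denominator positive when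
    \<open>c = 0\<close>.\<close>
  define t where "t = - b / (\<bar>c\<bar> + 1)"
  have "(\<bar>c\<bar> + 1)\<^sup>2 * (2 * t * b + t\<^sup>2 * c) = b\<^sup>2 * (c - 2 * (\<bar>c\<bar> + 1))"
  proof -
    have "t * (\<bar>c\<bar> + 1) = - b" by (simp add: t_def)
    moreover have "(\<bar>c\<bar> + 1)\<^sup>2 * (2 * t * b + t\<^sup>2 * c)
        = 2 * (t * (\<bar>c\<bar> + 1)) * (\<bar>c\<bar> + 1) * b + (t * (\<bar>c\<bar> + 1))\<^sup>2 * c"
      by (simp only: power2_eq_square) (simp only: algebra_simps)
    ultimately show ?thesis by (simp add: power2_eq_square algebra_simps)
  qed
  moreover have "b\<^sup>2 * (c - 2 * (\<bar>c\<bar> + 1)) < 0"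
    using \<open>b \<noteq> 0\<close> by (intro mult_pos_neg) auto
  ultimately show False
    using assms[of t] by (smt (verit) mult_nonneg_nonneg zero_le_power2)
qed

text \<open>A maximiser of \<open>x \<bullet> f x\<close> on the compact unit sphere of
  \<open>S\<close> is an eigenvector. Working inside an invariant subspace makes the result usable
  in an induction on dimension.\<close>

lemma selfadjoint_eigenvector_in_subspace:
  fixes f :: "'a::euclidean_space \<Rightarrow> 'a"
  assumes "linear f" and sym: "\<And>x y. x \<bullet> f y = f x \<bullet> y"
    and S: "subspace S" and inv: "f ` S \<subseteq> S" and nz: "S \<noteq> {0}"
  obtains v l where "v \<in> S" "norm v = 1" "f v = l *\<^sub>R v"
proof -
  interpret f: linear f by fact
  have cf: "continuous_on A f" for A
    using assms(1) linear_continuous_on linear_conv_bounded_linear by blast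
  obtain u where u: "u \<in> S" "u \<noteq> 0" using nz subspace_0[OF S] by blast
  have "u /\<^sub>R norm u \<in> sphere 0 1 \<inter> S"
    using u S by (auto simp: subspace_scale)
  then have "sphere 0 1 \<inter> S \<noteq> {}" by blast
  moreover have "compact (sphere 0 1 \<inter> S)"
    using closed_subspace[OF S] by (intro compact_Int_closed) auto
  moreover have "continuous_on (sphere 0 1 \<inter> S) (\<lambda>x. x \<bullet> f x)"
    by (intro continuous_intros cf)
  ultimately obtain v where v: "v \<in> sphere 0 1 \<inter> S"
    and vmax: "\<forall>x\<in>sphere 0 1 \<inter> S. x \<bullet> f x \<le> v \<bullet> f v"
    using continuous_attains_sup[of "sphere 0 1 \<inter> S" "\<lambda>x. x \<bullet> f x"] by blast
  define l where "l = v \<bullet> f v"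
  have vv: "v \<bullet> v = 1" using v by (simp add: dot_square_norm)
  \<comment> \<open>Homogeneity carries the maximum property from the unit sphere to all of
    \<open>S\<close>.\<close>
  have nonneg: "0 \<le> l * (x \<bullet> x) - x \<bullet> f x" if "x \<in> S" for x
  proof (cases "x = 0")
    case False
    have "(x /\<^sub>R norm x) \<bullet> f (x /\<^sub>R norm x) \<le> l"
      unfolding l_def using False that S by (intro vmax[rule_format]) (auto simp: subspace_scale)
    then have "(x \<bullet> f x) / (norm x)\<^sup>2 \<le> l"
      by (simp add: f.scale power2_eq_square field_simps)
    then show ?thesis
      using False by (simp add: field_simps power2_norm_eq_inner)
  qed (simp add: f.zero)
  \<comment> \<open>The residual of the eigenvalue equation. It stays in \<open>S\<close> by
    invariance and serves as its own test direction: the first-order term along \<open>w\<close> is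
    \<open>w \<bullet> w\<close>.\<close>
  define w where "w = l *\<^sub>R v - f v"
  have wS: "w \<in> S" and vS: "v \<in> S"
    using v inv S by (auto simp: w_def intro!: subspace_diff subspace_scale)
  \<comment> \<open>The form \<open>l * (x \<bullet> x) - x \<bullet> f x\<close> is minimal at \<open>v\<close>, so its derivative there vanishes.\<close>
  have "l * (v \<bullet> w) - f v \<bullet> w = 0"
  proof (rule quadratic_nonneg_imp_linear_coeff_zero)
    fix t :: real
    have "v + t *\<^sub>R w \<in> S" using wS vS S by (auto intro!: subspace_add subspace_scale)
    note nn = nonneg[OF this]
    have e1: "(v + t *\<^sub>R w) \<bullet> (v + t *\<^sub>R w) = v \<bullet> v + 2 * t * (v \<bullet> w) + t\<^sup>2 * (w \<bullet> w)"
      by (simp add: inner_add_left inner_add_right inner_commute[of w v] power2_eq_square algebra_simps)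
    have e2: "(v + t *\<^sub>R w) \<bullet> f (v + t *\<^sub>R w) = l + 2 * t * (f v \<bullet> w) + t\<^sup>2 * (w \<bullet> f w)"
      by (simp add: f.add f.scale inner_add_left inner_add_right sym[of v w]
          inner_commute[of w "f v"] power2_eq_square l_def distrib_left)
    show "0 \<le> 2 * t * (l * (v \<bullet> w) - f v \<bullet> w) + t\<^sup>2 * (l * (w \<bullet> w) - w \<bullet> f w)"
      using nn unfolding e1 e2 vv by (simp add: algebra_simps)
  qed
  moreover have "w \<bullet> w = l * (v \<bullet> w) - f v \<bullet> w"
    by (subst (1) w_def) (simp add: inner_diff_left)
  ultimately have "w \<bullet> w = 0" by simp
  then have "f v = l *\<^sub>R v" by (simp add: w_def)
  with v that show thesis by auto
qed

text \<open>Spectral theorem by strong induction on dimension: split off one unit eigenvector and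
  recurse on its orthogonal complement in \<open>S\<close>.\<close>

lemma selfadjoint_orthonormal_eigenbasis:
  fixes f :: "'a::euclidean_space \<Rightarrow> 'a"
  assumes "linear f" and sym: "\<And>x y. x \<bullet> f y = f x \<bullet> y"
    and "subspace S" and "f ` S \<subseteq> S"
  shows "\<exists>B l. finite B \<and> B \<subseteq> S \<and> (\<forall>v\<in>B. \<forall>w\<in>B. v \<bullet> w = (if v = w then 1 else 0)) \<and>
    (\<forall>v\<in>B. f v = l v *\<^sub>R v) \<and> (\<forall>x\<in>S. x = (\<Sum>v\<in>B. (x \<bullet> v) *\<^sub>R v))"
  using assms(3,4)
proof (induction "dim S" arbitrary: S rule: less_induct)
  case less
  interpret f: linear f by fact
  note S = less.prems(1)
  show ?case
  proof (cases "S = {0}")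
    case True
    then show ?thesis by (intro exI[of _ "{}"]) auto
  next
    case False
    then obtain v l where v: "v \<in> S" "norm v = 1" "f v = l *\<^sub>R v"
      using selfadjoint_eigenvector_in_subspace[OF assms(1) sym less.prems] by blast
    have vv: "v \<bullet> v = 1" using v by (simp add: dot_square_norm)
    define T where "T = {x \<in> S. x \<bullet> v = 0}"
    have T: "subspace T" using S unfolding T_def subspace_def by (auto simp: inner_add_left)
    \<comment> \<open>Self-adjointness gives
      \<open>f x \<bullet> v = x \<bullet> f v = l * (x \<bullet> v)\<close>, which is
      \<open>0\<close> on \<open>T\<close>.\<close>
    have fT: "f ` T \<subseteq> T"
      using less.prems(2) v(3) by (auto simp: T_def sym[symmetric])
    have dT: "dim T < dim S"
    proof (rule dim_psubset)
      have "v \<notin> T" using vv by (simp add: T_def)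
      then have "T \<subset> S" using v(1) unfolding T_def by blast
      then show "span T \<subset> span S" using T S by (metis span_eq_iff)
    qed
    obtain B m where B: "finite B" "B \<subseteq> T"
        "\<forall>v\<in>B. \<forall>w\<in>B. v \<bullet> w = (if v = w then 1 else 0)"
        "\<forall>v\<in>B. f v = m v *\<^sub>R v" "\<forall>x\<in>T. x = (\<Sum>v\<in>B. (x \<bullet> v) *\<^sub>R v)"
      using less.hyps[OF dT T fT] by (elim exE conjE) (rule that)
    have vB: "w \<bullet> v = 0" "v \<bullet> w = 0" if "w \<in> B" for w
      using B(2) that by (auto simp: T_def inner_commute)
    then have nB: "v \<notin> B" using vv by fastforce
    have rep: "x = (\<Sum>u\<in>insert v B. (x \<bullet> u) *\<^sub>R u)" if "x \<in> S" for x
    proof -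
      let ?y = "x - (x \<bullet> v) *\<^sub>R v"
      have "?y \<in> T"
        using that v S vv by (auto simp: T_def inner_diff_left intro!: subspace_diff subspace_scale)
      then have "?y = (\<Sum>u\<in>B. (?y \<bullet> u) *\<^sub>R u)" by (rule B(5)[rule_format])
      also have "\<dots> = (\<Sum>u\<in>B. (x \<bullet> u) *\<^sub>R u)"
        by (rule sum.cong) (auto simp: inner_diff_left vB)
      finally show ?thesis using B(1) nB by (simp add: algebra_simps)
    qed
    have eig: "\<forall>u\<in>insert v B. f u = (m(v := l)) u *\<^sub>R u" using B(4) v(3) nB by auto
    have orth: "\<forall>u\<in>insert v B. \<forall>w\<in>insert v B. u \<bullet> w = (if u = w then 1 else 0)"
      using B(3) vv vB nB by auto
    have fin: "finite (insert v B)" "insert v B \<subseteq> S" using B(1,2) v(1) by (auto simp: T_def)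
    show ?thesis
      by (intro exI[of _ "insert v B"] exI[of _ "m(v := l)"] conjI fin orth eig ballI rep)
  qed
qed

lemma psd_inner_commute:
  assumes "psd M"
  shows "x \<bullet> (M *v y) = (M *v x) \<bullet> y"
  using assms unfolding psd_def by (metis dot_lmul_matrix transpose_matrix_vector)

lemma psdI:
  fixes M :: "real ^ 'n ^ 'n"
  assumes "\<And>x y. x \<bullet> (M *v y) = (M *v x) \<bullet> y" and "\<And>x. 0 \<le> x \<bullet> (M *v x)"
  shows "psd M"
proof -
  have "transpose M *v x = M *v x" for x
    by (rule vector_eq_rdot[THEN iffD1]) (metis assms(1) dot_lmul_matrix transpose_matrix_vector)
  then show ?thesis
    using assms(2) by (simp add: psd_def matrix_eq)
qed

text \<open>In an orthonormal eigenbasis \<open>M\<close> acts by nonnegative scalings;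
  \<open>g\<close> scales by their square roots instead, so applying it twice gives
  \<open>M\<close>.\<close>

lemma psd_sqrt_exists:
  fixes M :: "real ^ 'n ^ 'n"
  assumes M: "psd M"
  shows "\<exists>R. psd R \<and> R ** R = M"
proof -
  obtain B l where B: "finite B"
      "\<forall>v\<in>B. \<forall>w\<in>B. v \<bullet> w = (if v = w then 1 else 0)"
      "\<forall>v\<in>B. M *v v = l v *\<^sub>R v" "\<forall>x\<in>UNIV. x = (\<Sum>v\<in>B. (x \<bullet> v) *\<^sub>R v)"
    using selfadjoint_orthonormal_eigenbasis[OF matrix_vector_mul_linear psd_inner_commute[OF M]
        subspace_UNIV subset_UNIV]
    by (elim exE conjE) (rule that)
  have l: "0 \<le> l v" if "v \<in> B" for v
  proof -
    have "0 \<le> v \<bullet> (M *v v)" using M by (simp add: psd_def)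
    then show ?thesis using B(2,3) that by simp
  qed
  define g where "g = (\<lambda>x. \<Sum>v\<in>B. (sqrt (l v) * (x \<bullet> v)) *\<^sub>R v)"
  have g: "linear g"
    by (rule linearI)
      (simp_all add: g_def inner_add_left sum.distrib algebra_simps scaleR_sum_right)
  have gv: "g v = sqrt (l v) *\<^sub>R v" if "v \<in> B" for v
  proof -
    have "g v = (\<Sum>w\<in>B. if w = v then sqrt (l v) *\<^sub>R v else 0)"
      unfolding g_def using that B(2) by (intro sum.cong) auto
    then show ?thesis using that B(1) by simp
  qed
  have gg: "g (g x) = M *v x" for x
  proof -
    have "g (g x) = (\<Sum>v\<in>B. (sqrt (l v) * (x \<bullet> v)) *\<^sub>R g v)"
      by (subst (2) g_def) (simp add: linear_sum[OF g] linear_scale[OF g])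
    also have "\<dots> = (\<Sum>v\<in>B. (x \<bullet> v) *\<^sub>R (M *v v))"
      using l by (intro sum.cong) (simp_all add: gv B(3))
    also have "\<dots> = M *v (\<Sum>v\<in>B. (x \<bullet> v) *\<^sub>R v)"
      by (simp only: linear_sum[OF matrix_vector_mul_linear] linear_scale[OF matrix_vector_mul_linear])
    also have "\<dots> = M *v x" using B(4)[rule_format, OF UNIV_I, of x] by (rule arg_cong[OF sym])
    finally show ?thesis .
  qed
  have "psd (matrix g)"
  proof (rule psdI)
    show "x \<bullet> (matrix g *v y) = (matrix g *v x) \<bullet> y" for x y
      by (simp add: fun_cong[OF matrix_vector_mul(2)[OF g]])
        (simp add: g_def inner_sum_left inner_sum_right mult_ac inner_commute)
    have "x \<bullet> g x = (\<Sum>v\<in>B. sqrt (l v) * (x \<bullet> v)\<^sup>2)" for x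
      by (simp add: g_def inner_sum_right power2_eq_square mult_ac)
    then show "0 \<le> x \<bullet> (matrix g *v x)" for x
      using l by (simp add: fun_cong[OF matrix_vector_mul(2)[OF g]] sum_nonneg)
  qed
  moreover have "matrix g ** matrix g = M"
    by (simp add: matrix_eq matrix_vector_mul_assoc[symmetric] fun_cong[OF matrix_vector_mul(2)[OF g]] gg)
  ultimately show ?thesis by blast
qed

text \<open>Existence of a root gives the choice in \<open>matrix_sqrt\<close> its meaning; later
  arguments reach the root through these two facts.\<close>

lemma
  assumes "psd M"
  shows psd_matrix_sqrt: "psd (matrix_sqrt M)"
    and matrix_sqrt_mult_self: "matrix_sqrt M ** matrix_sqrt M = M"
  using someI_ex[OF psd_sqrt_exists[OF assms]] by (simp_all add: matrix_sqrt_def)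

text \<open>Turns the bilinear form of \<open>M\<close> into a Euclidean inner product, so that
  Cauchy-Schwarz applies to it.\<close>

lemma inner_matrix_sqrt:
  assumes "psd M"
  shows "(matrix_sqrt M *v x) \<bullet> (matrix_sqrt M *v y) = x \<bullet> (M *v y)"
  by (metis assms matrix_sqrt_mult_self matrix_vector_mul_assoc psd_inner_commute psd_matrix_sqrt)

lemma norm_matrix_sqrt:
  assumes "psd M"
  shows "(norm (matrix_sqrt M *v x))\<^sup>2 = x \<bullet> (M *v x)"
  by (simp add: power2_norm_eq_inner inner_matrix_sqrt[OF assms])

section \<open>Linear functionals on the ellipsoid of means\<close>

lemma
  fixes M :: "real ^ 'n ^ 'n"
  assumes "invertible M"
  shows matrix_inv_mult_vec: "matrix_inv M *v (M *v x) = x"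
    and mult_matrix_inv_vec: "M *v (matrix_inv M *v x) = x"
proof -
  have "M ** matrix_inv M = mat 1 \<and> matrix_inv M ** M = mat 1"
    using someI_ex[of "\<lambda>N. M ** N = mat 1 \<and> N ** M = mat 1"] assms
    by (simp add: matrix_inv_def invertible_def)
  then show "matrix_inv M *v (M *v x) = x" "M *v (matrix_inv M *v x) = x"
    by (simp_all add: matrix_vector_mul_assoc)
qed

text \<open>Write \<open>y = M *v u\<close>. Then \<open>x \<bullet> y\<close> is the inner product
  of the root applied to \<open>x\<close> and to \<open>u\<close>, and the squared norm of the
  latter is the form bounded by \<open>\<rho>\<close>.\<close>

lemma abs_inner_le_mahalanobis:
  fixes M :: "real ^ 'n ^ 'n"
  assumes M: "psd M" "invertible M" and y: "y \<bullet> (matrix_inv M *v y) \<le> \<rho>"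
  shows "\<bar>x \<bullet> y\<bar> \<le> sqrt \<rho> * norm (matrix_sqrt M *v x)"
proof -
  define u where "u = matrix_inv M *v y"
  have yu: "y = M *v u" by (simp add: u_def mult_matrix_inv_vec M)
  have "(norm (matrix_sqrt M *v u))\<^sup>2 \<le> \<rho>"
    using y by (simp add: norm_matrix_sqrt M) (simp add: yu matrix_inv_mult_vec M inner_commute)
  then have "norm (matrix_sqrt M *v u) \<le> sqrt \<rho>" by (rule real_le_rsqrt)
  moreover have "\<bar>x \<bullet> y\<bar> \<le> norm (matrix_sqrt M *v x) * norm (matrix_sqrt M *v u)"
    using Cauchy_Schwarz_ineq2[of "matrix_sqrt M *v x" "matrix_sqrt M *v u"]
    by (simp add: inner_matrix_sqrt M yu)
  ultimately show ?thesis
    by (metis mult.commute mult_right_mono norm_ge_zero order_trans)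
qed

subsection \<open>Cantelli's inequality on the ambiguity set\<close>

text \<open>One-sided Chebyshev bound. \<open>V\<close> need only dominate the variance, which is
  all that the Loewner constraint provides.\<close>

lemma (in prob_space) cantelli_inequality:
  fixes X :: "'a \<Rightarrow> real"
  assumes X: "integrable M X" "integrable M (\<lambda>x. (X x - a)\<^sup>2)" "expectation X = a" and t: "0 < t"
    and V: "expectation (\<lambda>x. (X x - a)\<^sup>2) \<le> V"
  shows "prob {x \<in> space M. X x \<le> a - t} \<le> V / (V + t\<^sup>2)"
proof -
  have [measurable]: "X \<in> borel_measurable M" using X by auto
  have V0: "0 \<le> V" using V by (smt (verit) integral_nonneg_AE AE_I2 zero_le_power2)
  \<comment> \<open>The shift that optimises Markov's inequality for \<open>(X - a - u)\<^sup>2\<close>.\<close>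
  define u where "u = V / t"
  have u: "0 \<le> u" "u * t = V" using V0 t by (auto simp: u_def)
  have int: "integrable M (\<lambda>x. (X x - a)\<^sup>2 - 2 * u * (X x - a) + u\<^sup>2)"
    using X(1,2) by simp
  have "prob {x \<in> space M. X x \<le> a - t} * (t + u)\<^sup>2
      = expectation (\<lambda>x. indicator {x \<in> space M. X x \<le> a - t} x * (t + u)\<^sup>2)"
    by simp
  also have "\<dots> \<le> expectation (\<lambda>x. (X x - a)\<^sup>2 - 2 * u * (X x - a) + u\<^sup>2)"
  proof (rule integral_mono[OF _ int])
    fix x
    show "indicator {x \<in> space M. X x \<le> a - t} x * (t + u)\<^sup>2 \<le> (X x - a)\<^sup>2 - 2 * u * (X x - a) + u\<^sup>2"
    proof -
      have sq: "(X x - a)\<^sup>2 - 2 * u * (X x - a) + u\<^sup>2 = (a + u - X x)\<^sup>2"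
        by (simp add: power2_eq_square algebra_simps)
      have "(t + u)\<^sup>2 \<le> (a + u - X x)\<^sup>2" if "X x \<le> a - t"
        using that t u by (intro power_mono) auto
      then show ?thesis unfolding sq by (simp add: indicator_def)
    qed
  qed (auto intro!: integrable_mult_left integrable_real_indicator simp: emeasure_finite less_top[symmetric])
  \<comment> \<open>The linear term integrates to zero because \<open>a\<close> is the mean.\<close>
  also have "\<dots> \<le> V + u\<^sup>2"
    using X V by (simp add: prob_space)
  finally have *: "prob {x \<in> space M. X x \<le> a - t} * (t + u)\<^sup>2 \<le> V + u\<^sup>2" .
  \<comment> \<open>Since \<open>u * t = V\<close>, both \<open>V + t\<^sup>2\<close> and
    \<open>V + u\<^sup>2\<close> contain the factor \<open>t + u\<close>.\<close>
  have "V + u\<^sup>2 = (V / (V + t\<^sup>2)) * (t + u)\<^sup>2"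
  proof -
    have "V + t\<^sup>2 = t * (t + u)" "V + u\<^sup>2 = u * (t + u)" "V = u * t"
      using u by (auto simp: power2_eq_square algebra_simps)
    moreover have "t + u \<noteq> 0" using t u by simp
    ultimately show ?thesis using t by (simp add: power2_eq_square)
  qed
  with * have "prob {x \<in> space M. X x \<le> a - t} * (t + u)\<^sup>2 \<le> (V / (V + t\<^sup>2)) * (t + u)\<^sup>2" by simp
  then show ?thesis using t u by (elim mult_right_le_imp_le) simp
qed

section \<open>Moments of linear functionals under the ambiguity set\<close>

lemma integrable_of_integrable_norm_sq:
  fixes F :: "(real ^ 'n) measure"
  assumes "prob_space F" "sets F = sets borel" "integrable F (\<lambda>x. (norm x)\<^sup>2)"
  shows "integrable F (\<lambda>x. x)"
proof -
  interpret prob_space F by fact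
  have [measurable]: "(\<lambda>x. x) \<in> borel_measurable F" using assms(2) by (simp add: measurable_def sets_eq_imp_space_eq[OF assms(2)])
  show ?thesis
  proof (rule Bochner_Integration.integrable_bound)
    show "integrable F (\<lambda>x. 1 + (norm x)\<^sup>2)" using assms(3) by simp
    show "AE x in F. norm x \<le> norm (1 + (norm x)\<^sup>2)"
    proof (rule AE_I2)
      fix x :: "real ^ 'n"
      have "0 \<le> (norm x - 1)\<^sup>2" by simp
      then show "norm x \<le> norm (1 + (norm x)\<^sup>2)"
        by (simp add: power2_eq_square algebra_simps) (smt (verit) mult_nonneg_nonneg norm_ge_zero)
    qed
  qed simp
qed

text \<open>Identifies the quadratic form of the covariance matrix with a scalar variance; this
  links the Loewner constraint to Cantelli's inequality.\<close>

lemma inner_covariance_matrix: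
  fixes F :: "(real ^ 'n) measure"
  assumes F: "prob_space F" "sets F = sets borel" "integrable F (\<lambda>x. (norm x)\<^sup>2)"
  shows "integrable F (\<lambda>r. (x \<bullet> r - x \<bullet> mean_vector F)\<^sup>2)"
    and "x \<bullet> (covariance_matrix F *v x) = (\<integral>r. (x \<bullet> r - x \<bullet> mean_vector F)\<^sup>2 \<partial>F)"
proof -
  interpret prob_space F by fact
  have [measurable]: "(\<lambda>x. x) \<in> borel_measurable F"
    using F(2) by (simp add: measurable_def sets_eq_imp_space_eq[OF F(2)])
  define m where "m = mean_vector F"
  have int: "integrable F (\<lambda>r. (r $ i - m $ i) * (r $ j - m $ j))" for i j
  proof (rule Bochner_Integration.integrable_bound)
    show "integrable F (\<lambda>r. 2 * ((norm r)\<^sup>2 + (norm m)\<^sup>2))" using F(3) by simp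
    show "AE r in F. norm ((r $ i - m $ i) * (r $ j - m $ j)) \<le> norm (2 * ((norm r)\<^sup>2 + (norm m)\<^sup>2))"
    proof (rule AE_I2)
      fix r :: "real ^ 'n"
      have "norm ((r $ i - m $ i) * (r $ j - m $ j)) \<le> norm (r - m) * norm (r - m)"
        using component_le_norm_cart[of "r - m"] by (simp add: abs_mult mult_mono)
      also have "\<dots> \<le> (norm r + norm m) * (norm r + norm m)"
        by (intro mult_mono norm_triangle_ineq4) auto
      also have "\<dots> \<le> 2 * ((norm r)\<^sup>2 + (norm m)\<^sup>2)"
        using zero_le_power2[of "norm r - norm m"] by (simp add: power2_eq_square algebra_simps)
      finally show "norm ((r $ i - m $ i) * (r $ j - m $ j)) \<le> norm (2 * ((norm r)\<^sup>2 + (norm m)\<^sup>2))"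
        by simp
    qed
    have "(\<lambda>r. r $ i) \<in> borel_measurable F" for i
      by (simp add: cart_eq_inner_axis)
    then show "(\<lambda>r. (r $ i - m $ i) * (r $ j - m $ j)) \<in> borel_measurable F" by simp
  qed
  \<comment> \<open>Expanding the square over pairs of coordinates lets the integral pass through
    finite sums to the matrix entries.\<close>
  have sq: "(x \<bullet> r - x \<bullet> m)\<^sup>2
      = (\<Sum>i\<in>UNIV. \<Sum>j\<in>UNIV. (x $ i * x $ j) * ((r $ i - m $ i) * (r $ j - m $ j)))" for r
  proof -
    have "x \<bullet> r - x \<bullet> m = (\<Sum>i\<in>UNIV. x $ i * (r $ i - m $ i))"
      by (simp add: inner_vec_def sum_subtractf right_diff_distrib)
    then show ?thesis by (simp add: power2_eq_square sum_product mult_ac)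
  qed
  show "integrable F (\<lambda>r. (x \<bullet> r - x \<bullet> mean_vector F)\<^sup>2)"
    unfolding m_def[symmetric] sq by (intro Bochner_Integration.integrable_sum integrable_mult_right int)
  show "x \<bullet> (covariance_matrix F *v x) = (\<integral>r. (x \<bullet> r - x \<bullet> mean_vector F)\<^sup>2 \<partial>F)"
    unfolding m_def[symmetric] sq
    by (simp add: int Bochner_Integration.integral_sum covariance_matrix_def m_def[symmetric]
        inner_vec_def matrix_vector_mult_def sum_distrib_left mult_ac)
qed

text \<open>Everything that the scalar \<open>\<tau> \<bullet> r\<close> inherits from membership:
  the mean bound comes from the ellipsoid, the variance bound from testing the Loewner order at
  \<open>\<tau>\<close>.\<close>

lemma ambiguity_setD:
  fixes \<Sigma> :: "real ^ 'n ^ 'n"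
  assumes F: "F \<in> ambiguity_set \<mu> \<Sigma> \<rho>1 \<rho>2" and S: "psd \<Sigma>" "invertible \<Sigma>"
  shows "prob_space F" and "sets F = sets borel"
    and "integrable F (\<lambda>r. \<tau> \<bullet> r)"
    and "integrable F (\<lambda>r. (\<tau> \<bullet> r - \<tau> \<bullet> mean_vector F)\<^sup>2)"
    and "(\<integral>r. \<tau> \<bullet> r \<partial>F) = \<tau> \<bullet> mean_vector F"
    and "\<tau> \<bullet> \<mu> - sqrt \<rho>1 * norm (matrix_sqrt \<Sigma> *v \<tau>) \<le> \<tau> \<bullet> mean_vector F"
    and "(\<integral>r. (\<tau> \<bullet> r - \<tau> \<bullet> mean_vector F)\<^sup>2 \<partial>F) \<le> \<rho>2 * (norm (matrix_sqrt \<Sigma> *v \<tau>))\<^sup>2"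
proof -
  show 1: "prob_space F" "sets F = sets borel" using F by (auto simp: ambiguity_set_def)
  have 2: "integrable F (\<lambda>x. (norm x)\<^sup>2)" using F by (simp add: ambiguity_set_def)
  note int = integrable_of_integrable_norm_sq[OF 1 2]
  show "integrable F (\<lambda>r. \<tau> \<bullet> r)" "(\<integral>r. \<tau> \<bullet> r \<partial>F) = \<tau> \<bullet> mean_vector F"
    using int by (auto simp: mean_vector_def)
  show "integrable F (\<lambda>r. (\<tau> \<bullet> r - \<tau> \<bullet> mean_vector F)\<^sup>2)"
    by (rule inner_covariance_matrix[OF 1 2])
  have "\<bar>\<tau> \<bullet> (mean_vector F - \<mu>)\<bar> \<le> sqrt \<rho>1 * norm (matrix_sqrt \<Sigma> *v \<tau>)"
    using F by (intro abs_inner_le_mahalanobis[OF S]) (simp add: ambiguity_set_def)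
  then show "\<tau> \<bullet> \<mu> - sqrt \<rho>1 * norm (matrix_sqrt \<Sigma> *v \<tau>) \<le> \<tau> \<bullet> mean_vector F"
    by (simp add: inner_diff_right)
  have "0 \<le> \<tau> \<bullet> ((\<rho>2 *\<^sub>R \<Sigma> - covariance_matrix F) *v \<tau>)"
    using F by (simp add: ambiguity_set_def loewner_le_def psd_def)
  then show "(\<integral>r. (\<tau> \<bullet> r - \<tau> \<bullet> mean_vector F)\<^sup>2 \<partial>F) \<le> \<rho>2 * (norm (matrix_sqrt \<Sigma> *v \<tau>))\<^sup>2"
    by (simp add: matrix_vector_mult_diff_rdistrib inner_diff_right inner_covariance_matrix(2)[OF 1 2]
        norm_matrix_sqrt[OF S(1)] scaleR_matrix_vector_assoc[symmetric])
qed

section \<open>A single chance constraint: sufficiency\<close>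

text \<open>Removes the extended reals. At \<open>h = 1\<close> the convention
  \<open>0 * \<infinity> = 0\<close> leaves the constraint satisfiable only when the worst-case
  deviation \<open>sqrt \<rho>2 * n\<close> vanishes.\<close>

lemma chance_constraint_iff:
  fixes n :: real
  assumes "0 \<le> h" "h \<le> 1" "0 \<le> \<rho>2" "0 \<le> n"
  shows "ereal m - (sqrt_odds h * ereal (sqrt \<rho>2) + ereal (sqrt \<rho>1)) * ereal n \<ge> ereal \<xi> \<longleftrightarrow>
    (if h < 1 then \<xi> \<le> m - (sqrt (h / (1 - h)) * sqrt \<rho>2 + sqrt \<rho>1) * n
     else sqrt \<rho>2 * n = 0 \<and> \<xi> \<le> m - sqrt \<rho>1 * n)"
proof (cases "h < 1 \<or> \<rho>2 = 0 \<or> n = 0")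
  case True
  then show ?thesis using assms by (auto simp: sqrt_odds_def zero_ereal_def[symmetric])
next
  \<comment> \<open>Here \<open>h = 1\<close> and both \<open>\<rho>2\<close> and \<open>n\<close>
    are positive, so the left side of the constraint is minus infinity.\<close>
  case False
  then show ?thesis using assms by (auto simp: sqrt_odds_def)
qed

text \<open>The constraint forces \<open>t\<close> to be at least \<open>sqrt (h / (1 - h))\<close>
  standard deviations, the deviation being measured by its bound \<open>sqrt V\<close>. For
  \<open>h < 1\<close> and \<open>0 < V\<close> this says that \<open>h\<close> is at most
  Cantelli's lower bound.\<close>

lemma chance_constraint_sufficient:
  fixes \<Sigma> :: "real ^ 'n ^ 'n"
  assumes F: "F \<in> ambiguity_set \<mu> \<Sigma> \<rho>1 \<rho>2" and S: "psd \<Sigma>" "invertible \<Sigma>"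
    and \<rho>: "0 \<le> \<rho>2" and h: "0 \<le> h" "h \<le> 1"
    and c: "ereal (\<tau> \<bullet> \<mu>) - (sqrt_odds h * ereal (sqrt \<rho>2) + ereal (sqrt \<rho>1))
            * ereal (norm (matrix_sqrt \<Sigma> *v \<tau>)) \<ge> ereal \<xi>"
  shows "h \<le> measure F {r \<in> space F. \<tau> \<bullet> r \<ge> \<xi>}"
proof -
  note FD = ambiguity_setD[OF F S]
  interpret prob_space F by (rule FD)
  define n where "n = norm (matrix_sqrt \<Sigma> *v \<tau>)"
  define a where "a = \<tau> \<bullet> mean_vector F"
  define V where "V = \<rho>2 * n\<^sup>2"
  define t where "t = a - \<xi>"
  have n: "0 \<le> n" by (simp add: n_def)
  have [measurable]: "(\<lambda>r. \<tau> \<bullet> r) \<in> borel_measurable F" using FD(3)[of \<tau>] by auto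
  have var: "(\<integral>r. (\<tau> \<bullet> r - a)\<^sup>2 \<partial>F) \<le> V" using FD(7)[of \<tau>] by (simp add: a_def V_def n_def)
  have a: "\<tau> \<bullet> \<mu> - sqrt \<rho>1 * n \<le> a" using FD(6)[of \<tau>] by (simp add: a_def n_def)
  note c' = c[unfolded chance_constraint_iff[OF h \<rho> norm_ge_zero], folded n_def]
  have deg: "measure F {r \<in> space F. \<tau> \<bullet> r \<ge> \<xi>} = 1" if "V = 0" "0 \<le> t"
  proof -
    have "(\<integral>r. (\<tau> \<bullet> r - a)\<^sup>2 \<partial>F) = 0"
      using var that by (intro antisym) auto
    then have "AE r in F. (\<tau> \<bullet> r - a)\<^sup>2 = 0"
      using FD(4)[of \<tau>] by (subst (asm) integral_nonneg_eq_0_iff_AE) (auto simp: a_def)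
    then have "AE r in F. \<tau> \<bullet> r \<ge> \<xi>" by eventually_elim (use that in \<open>auto simp: t_def\<close>)
    then show ?thesis by (simp add: prob_Collect_eq_1)
  qed
  show ?thesis
  proof (cases "h < 1")
    case False
    then show ?thesis using c' a deg h by (auto simp: V_def t_def)
  next
    case True
    define c where "c = sqrt (h / (1 - h))"
    have c0: "0 \<le> c" and c2: "c\<^sup>2 = h / (1 - h)" using h True by (auto simp: c_def)
    have t: "c * (sqrt \<rho>2 * n) \<le> t"
      using c' True a by (simp add: t_def c_def algebra_simps)
    have t0: "0 \<le> t" using t c0 n \<rho> by (smt (verit) mult_nonneg_nonneg real_sqrt_ge_zero)
    show ?thesis
    \<comment> \<open>Outside these two cases \<open>h\<close> and \<open>V\<close> are positive,
      which forces the strict \<open>0 < t\<close> required by Cantelli.\<close>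
    proof (cases "h = 0 \<or> V = 0")
      case True
      then show ?thesis using deg t0 h by auto
    next
      case False
      then have hp: "0 < h" and Vp: "0 < V" using h \<rho> by (auto simp: V_def zero_less_mult_iff)
      have cp: "0 < c" using hp True by (simp add: c_def)
      have "0 < sqrt \<rho>2 * n" using Vp \<rho> n by (auto simp: V_def zero_less_mult_iff)
      then have tp: "0 < t" using t cp by (smt (verit) mult_pos_pos)
      have "(c * (sqrt \<rho>2 * n))\<^sup>2 \<le> t\<^sup>2" using t c0 n \<rho> by (intro power_mono) auto
      then have "h / (1 - h) * V \<le> t\<^sup>2"
        using \<rho> by (simp add: power_mult_distrib c2 V_def)
      then have "h * (V + t\<^sup>2) \<le> t\<^sup>2" using True by (simp add: field_simps)
      then have "h \<le> t\<^sup>2 / (V + t\<^sup>2)" using Vp by (simp add: pos_le_divide_eq add_pos_nonneg)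
      also have "\<dots> = 1 - V / (V + t\<^sup>2)"
        using add_pos_nonneg[OF Vp zero_le_power2[of t]] by (simp add: field_simps)
      also have "\<dots> \<le> 1 - prob {r \<in> space F. \<tau> \<bullet> r \<le> a - t}"
        using cantelli_inequality[OF FD(3)[of \<tau>] FD(4)[of \<tau>] FD(5)[of \<tau>] tp var[unfolded a_def]]
        by (simp add: a_def)
      \<comment> \<open>The two closed half-spaces cover the space but overlap where
        \<open>\<tau> \<bullet> r = \<xi>\<close>, so a union bound replaces
        complementation.\<close>
      also have "\<dots> \<le> prob {r \<in> space F. \<tau> \<bullet> r \<ge> \<xi>}"
      proof -
        have "prob (space F) = prob ({r \<in> space F. \<tau> \<bullet> r \<ge> \<xi>} \<union> {r \<in> space F. \<tau> \<bullet> r \<le> a - t})"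
          by (rule arg_cong[where f = prob]) (auto simp: t_def)
        also have "\<dots> \<le> prob {r \<in> space F. \<tau> \<bullet> r \<ge> \<xi>} + prob {r \<in> space F. \<tau> \<bullet> r \<le> a - t}"
          by (rule measure_Un_le) auto
        finally show ?thesis by (simp add: prob_space)
      qed
      finally show ?thesis .
    qed
  qed
qed

subsection \<open>Extremal two-point laws\<close>

text \<open>The image is taken on \<open>borel\<close> because \<open>ambiguity_set\<close>
  prescribes the Borel sets; equal points \<open>u\<close> and \<open>w\<close> give a point
  mass.\<close>

definition two_point_law :: "real \<Rightarrow> 'a \<Rightarrow> 'a \<Rightarrow> 'a::topological_space measure" where
  "two_point_law \<pi> u w = distr (measure_pmf (bernoulli_pmf \<pi>)) borel (\<lambda>b. if b then u else w)"

lemma space_two_point_law [simp]: "space (two_point_law \<pi> u w) = UNIV"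
  and sets_two_point_law [simp]: "sets (two_point_law \<pi> u w) = sets borel"
  by (simp_all add: two_point_law_def)

lemma prob_space_two_point_law: "prob_space (two_point_law \<pi> u w)"
  unfolding two_point_law_def by (rule measure_pmf.prob_space_distr) simp

lemma
  fixes f :: "'a::topological_space \<Rightarrow> 'b::{banach, second_countable_topology}"
  assumes "0 \<le> \<pi>" "\<pi> \<le> 1" and f: "f \<in> borel_measurable borel"
  shows integrable_two_point_law: "integrable (two_point_law \<pi> u w) f"
    and integral_two_point_law: "(\<integral>x. f x \<partial>two_point_law \<pi> u w) = \<pi> *\<^sub>R f u + (1 - \<pi>) *\<^sub>R f w"
  using assms unfolding two_point_law_def
  by (simp_all add: integrable_distr_eq integral_distr integrable_measure_pmf_finite
      integral_measure_pmf[of UNIV] UNIV_bool add.commute)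

lemma measure_two_point_law:
  assumes "A \<in> sets borel"
  shows "measure (two_point_law \<pi> u w) A = measure (measure_pmf (bernoulli_pmf \<pi>)) {b. (if b then u else w) \<in> A}"
  using assms by (simp add: two_point_law_def measure_distr vimage_def)

text \<open>The scalar law on \<open>x\<close>, \<open>y\<close> is standardised, so moving along
  \<open>e\<close> from \<open>m\<close> gives mean \<open>m\<close> and covariance
  \<open>e e^T\<close>; the last assumption is \<open>e e^T \<preceq> \<rho>2 \<Sigma>\<close> in
  terms of quadratic forms.\<close>

lemma two_point_law_in_ambiguity_set:
  fixes \<Sigma> :: "real ^ 'n ^ 'n"
  assumes \<pi>: "0 \<le> \<pi>" "\<pi> \<le> 1" and S: "psd \<Sigma>"
    and xy: "\<pi> * x + (1 - \<pi>) * y = 0" "\<pi> * x\<^sup>2 + (1 - \<pi>) * y\<^sup>2 = 1"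
    and m: "(m - \<mu>) \<bullet> (matrix_inv \<Sigma> *v (m - \<mu>)) \<le> \<rho>1"
    and e: "\<And>v. (e \<bullet> v)\<^sup>2 \<le> \<rho>2 * (v \<bullet> (\<Sigma> *v v))"
  shows "two_point_law \<pi> (m + x *\<^sub>R e) (m + y *\<^sub>R e) \<in> ambiguity_set \<mu> \<Sigma> \<rho>1 \<rho>2"
    and "mean_vector (two_point_law \<pi> (m + x *\<^sub>R e) (m + y *\<^sub>R e)) = m"
proof -
  let ?F = "two_point_law \<pi> (m + x *\<^sub>R e) (m + y *\<^sub>R e)"
  have "mean_vector ?F = (\<pi> + (1 - \<pi>)) *\<^sub>R m + (\<pi> * x + (1 - \<pi>) * y) *\<^sub>R e"
    unfolding mean_vector_def by (subst integral_two_point_law) (use \<pi> in \<open>simp_all add: algebra_simps\<close>)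
  then show mean: "mean_vector ?F = m" using xy by simp
  have "covariance_matrix ?F $ i $ j = (\<pi> * x\<^sup>2 + (1 - \<pi>) * y\<^sup>2) * (e $ i * e $ j)" for i j
    unfolding covariance_matrix_def mean
    by (simp, subst integral_two_point_law) (use \<pi> in \<open>simp_all add: algebra_simps power2_eq_square cart_eq_inner_axis\<close>)
  then have cov: "covariance_matrix ?F = (\<chi> i j. e $ i * e $ j)" using xy by (simp add: vec_eq_iff)
  have cov_v: "covariance_matrix ?F *v v = (e \<bullet> v) *\<^sub>R e" for v
    by (simp add: cov vec_eq_iff matrix_vector_mult_def inner_vec_def sum_distrib_left mult_ac)
  have "loewner_le (covariance_matrix ?F) (\<rho>2 *\<^sub>R \<Sigma>)"
    unfolding loewner_le_def
  proof (rule psdI)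
    have D: "(\<rho>2 *\<^sub>R \<Sigma> - covariance_matrix ?F) *v v = \<rho>2 *\<^sub>R (\<Sigma> *v v) - (e \<bullet> v) *\<^sub>R e" for v
      by (simp add: matrix_vector_mult_diff_rdistrib cov_v scaleR_matrix_vector_assoc[symmetric])
    show "v \<bullet> ((\<rho>2 *\<^sub>R \<Sigma> - covariance_matrix ?F) *v w) = ((\<rho>2 *\<^sub>R \<Sigma> - covariance_matrix ?F) *v v) \<bullet> w" for v w
      unfolding D by (simp add: inner_diff_left inner_diff_right psd_inner_commute[OF S] inner_commute[of v e])
    show "0 \<le> v \<bullet> ((\<rho>2 *\<^sub>R \<Sigma> - covariance_matrix ?F) *v v)" for v
      unfolding D using e[of v] by (simp add: inner_diff_right inner_commute[of v e] power2_eq_square)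
  qed
  moreover have "integrable ?F (\<lambda>x. (norm x)\<^sup>2)"
    using \<pi> by (intro integrable_two_point_law) simp_all
  ultimately show "?F \<in> ambiguity_set \<mu> \<Sigma> \<rho>1 \<rho>2"
    using m by (simp add: ambiguity_set_def prob_space_two_point_law mean)
qed

text \<open>The case of direction \<open>0\<close>: both atoms coincide and the covariance is
  zero.\<close>

lemma point_law_in_ambiguity_set:
  fixes \<Sigma> :: "real ^ 'n ^ 'n"
  assumes S: "psd \<Sigma>" and \<rho>: "0 \<le> \<rho>2" and m: "(m - \<mu>) \<bullet> (matrix_inv \<Sigma> *v (m - \<mu>)) \<le> \<rho>1"
  shows "two_point_law (1/2) m m \<in> ambiguity_set \<mu> \<Sigma> \<rho>1 \<rho>2"
    and "mean_vector (two_point_law (1/2) m m) = m"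
  using two_point_law_in_ambiguity_set[of "1/2" \<Sigma> 1 "-1" m \<mu> \<rho>1 0 \<rho>2] assms
  by (auto simp: psd_def)

lemma ambiguity_set_nonempty:
  fixes \<Sigma> :: "real ^ 'n ^ 'n"
  assumes "psd \<Sigma>" "0 \<le> \<rho>1" "0 \<le> \<rho>2"
  shows "ambiguity_set \<mu> \<Sigma> \<rho>1 \<rho>2 \<noteq> {}"
  using point_law_in_ambiguity_set(1)[of \<Sigma> \<rho>2 \<mu> \<mu> \<rho>1] assms by auto

section \<open>Sharpness of the mean bound and of the single chance constraint\<close>

text \<open>The equality case of Cauchy-Schwarz: the lowest value on the ellipsoid is reached from
  \<open>\<mu>\<close> in the direction of minus \<open>\<Sigma> *v \<tau>\<close>.\<close>

lemma exists_worst_mean: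
  fixes \<Sigma> :: "real ^ 'n ^ 'n"
  assumes S: "psd \<Sigma>" "invertible \<Sigma>" and \<rho>: "0 \<le> \<rho>1"
  obtains m where "(m - \<mu>) \<bullet> (matrix_inv \<Sigma> *v (m - \<mu>)) \<le> \<rho>1"
    and "\<tau> \<bullet> m = \<tau> \<bullet> \<mu> - sqrt \<rho>1 * norm (matrix_sqrt \<Sigma> *v \<tau>)"
proof -
  define n where "n = norm (matrix_sqrt \<Sigma> *v \<tau>)"
  have n2: "\<tau> \<bullet> (\<Sigma> *v \<tau>) = n\<^sup>2" by (simp add: n_def norm_matrix_sqrt S)
  show thesis
  proof (cases "n = 0")
    case True
    then show ?thesis using that[of \<mu>] \<rho> by (simp add: n_def[symmetric])
  next
    case False
    \<comment> \<open>Chosen so that \<open>c\<^sup>2 * n\<^sup>2 = \<rho>1\<close>, which puts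
      \<open>m\<close> on the boundary of the ellipsoid.\<close>
    define c where "c = sqrt \<rho>1 / n"
    define m where "m = \<mu> - c *\<^sub>R (\<Sigma> *v \<tau>)"
    have "(m - \<mu>) \<bullet> (matrix_inv \<Sigma> *v (m - \<mu>)) = c\<^sup>2 * (\<tau> \<bullet> (\<Sigma> *v \<tau>))"
      by (simp add: m_def matrix_inv_mult_vec S inner_commute power2_eq_square
          linear_neg[OF matrix_vector_mul_linear] linear_scale[OF matrix_vector_mul_linear])
    also have "\<dots> = \<rho>1" using \<rho> False by (simp add: n2 c_def power_divide)
    finally have 1: "(m - \<mu>) \<bullet> (matrix_inv \<Sigma> *v (m - \<mu>)) \<le> \<rho>1" by simp
    have "\<tau> \<bullet> m = \<tau> \<bullet> \<mu> - sqrt \<rho>1 * n"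
      using False by (simp add: m_def inner_diff_right n2 c_def power2_eq_square)
    with 1 that show ?thesis by (simp add: n_def)
  qed
qed

text \<open>The witness \<open>h\<close> is Cantelli's bound at the lowest mean, or \<open>1\<close>
  when the largest deviation is zero. The last conjunct says that the worst-case probability is at
  most \<open>h\<close>.\<close>

lemma chance_constraint_necessary:
  fixes \<Sigma> :: "real ^ 'n ^ 'n"
  assumes S: "psd \<Sigma>" "invertible \<Sigma>" and \<rho>: "0 \<le> \<rho>1" "0 \<le> \<rho>2"
    and pos: "\<And>F. F \<in> ambiguity_set \<mu> \<Sigma> \<rho>1 \<rho>2 \<Longrightarrow> 0 < measure F {r \<in> space F. \<tau> \<bullet> r \<ge> \<xi>}"
  shows "\<exists>h. 0 \<le> h \<and> h \<le> 1 \<and>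
    ereal (\<tau> \<bullet> \<mu>) - (sqrt_odds h * ereal (sqrt \<rho>2) + ereal (sqrt \<rho>1))
            * ereal (norm (matrix_sqrt \<Sigma> *v \<tau>)) \<ge> ereal \<xi> \<and>
    (\<forall>d>0. \<exists>F\<in>ambiguity_set \<mu> \<Sigma> \<rho>1 \<rho>2. measure F {r \<in> space F. \<tau> \<bullet> r \<ge> \<xi>} \<le> h + d)"
proof -
  define n where "n = norm (matrix_sqrt \<Sigma> *v \<tau>)"
  have n: "0 \<le> n" and n2: "\<tau> \<bullet> (\<Sigma> *v \<tau>) = n\<^sup>2" by (simp_all add: n_def norm_matrix_sqrt S)
  obtain m where m: "(m - \<mu>) \<bullet> (matrix_inv \<Sigma> *v (m - \<mu>)) \<le> \<rho>1"
    and tm: "\<tau> \<bullet> m = \<tau> \<bullet> \<mu> - sqrt \<rho>1 * n"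
    using exists_worst_mean[OF S \<rho>(1)] unfolding n_def by metis
  define s where "s = sqrt \<rho>2 * n"
  define t where "t = \<tau> \<bullet> m - \<xi>"
  have s0: "0 \<le> s" using \<rho> n by (simp add: s_def)
  have half [measurable]: "{r. \<xi> \<le> \<tau> \<bullet> r} \<in> sets borel" by measurable
  \<comment> \<open>If \<open>t\<close> were negative, the point law at the worst mean would miss
    the half-space entirely, against \<open>pos\<close>.\<close>
  have t0: "0 \<le> t"
    using pos[OF point_law_in_ambiguity_set(1)[OF S(1) \<rho>(2) m]] half
    by (auto simp: t_def measure_two_point_law intro: ccontr)
  show ?thesis
  proof (cases "s = 0")
    case True
    obtain F where F: "F \<in> ambiguity_set \<mu> \<Sigma> \<rho>1 \<rho>2"
      using ambiguity_set_nonempty[OF S(1) \<rho>] by blast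
    have "measure F A \<le> 1" for A
      using ambiguity_setD(1)[OF F S] by (rule prob_space.prob_le_1)
    then have "\<forall>d>0. \<exists>F\<in>ambiguity_set \<mu> \<Sigma> \<rho>1 \<rho>2. measure F {r \<in> space F. \<tau> \<bullet> r \<ge> \<xi>} \<le> 1 + d"
      using F by (auto intro!: bexI[of _ F] add_increasing2)
    moreover have "ereal (\<tau> \<bullet> \<mu>) - (sqrt_odds 1 * ereal (sqrt \<rho>2) + ereal (sqrt \<rho>1))
            * ereal (norm (matrix_sqrt \<Sigma> *v \<tau>)) \<ge> ereal \<xi>"
      unfolding chance_constraint_iff[OF zero_le_one order_refl \<rho>(2) norm_ge_zero]
      using True t0 tm by (simp add: n_def[symmetric] s_def t_def)
    ultimately show ?thesis by (intro exI[of _ 1]) simp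
  next
    case False
    then have s_pos: "0 < s" and np: "0 < n" using s0 n by (auto simp: s_def less_le)
    define z where "z = t / s"
    \<comment> \<open>This is \<open>t\<^sup>2 / (s\<^sup>2 + t\<^sup>2)\<close>; its odds are
      \<open>z\<^sup>2\<close>, which makes the constraint tight.\<close>
    define h where "h = z\<^sup>2 / (1 + z\<^sup>2)"
    have z0: "0 \<le> z" using t0 s0 by (simp add: z_def)
    have z1: "0 < 1 + z\<^sup>2" for z :: real by (simp add: add_pos_nonneg)
    have h: "0 \<le> h" "h < 1" using z1[of z] by (auto simp: h_def)
    have "1 - h = 1 / (1 + z\<^sup>2)" using z1[of z] by (simp add: h_def field_simps)
    then have "h / (1 - h) = z\<^sup>2" using z1[of z] by (simp add: h_def)
    then have "sqrt (h / (1 - h)) = z" using z0 by simp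
    then have "(sqrt (h / (1 - h)) * sqrt \<rho>2 + sqrt \<rho>1) * n = z * s + sqrt \<rho>1 * n"
      by (simp add: s_def distrib_right mult.assoc)
    also have "z * s = t" using s_pos by (simp add: z_def)
    finally have con: "\<xi> \<le> \<tau> \<bullet> \<mu> - (sqrt (h / (1 - h)) * sqrt \<rho>2 + sqrt \<rho>1) * n"
      by (simp add: t_def tm)
    \<comment> \<open>Among the directions with \<open>e e\<^sup>T \<preceq> \<rho>2 \<Sigma>\<close>, this one gives \<open>\<tau> \<bullet> r\<close> the largest variance.\<close>
    define e where "e = (sqrt \<rho>2 / n) *\<^sub>R (\<Sigma> *v \<tau>)"
    have te: "\<tau> \<bullet> e = s" using np by (simp add: e_def n2 s_def power2_eq_square)
    have e: "(e \<bullet> v)\<^sup>2 \<le> \<rho>2 * (v \<bullet> (\<Sigma> *v v))" for v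
    proof -
      have "(\<tau> \<bullet> (\<Sigma> *v v))\<^sup>2 \<le> n\<^sup>2 * (v \<bullet> (\<Sigma> *v v))"
        using Cauchy_Schwarz_ineq[of "matrix_sqrt \<Sigma> *v \<tau>" "matrix_sqrt \<Sigma> *v v"]
        by (simp add: inner_matrix_sqrt S n2)
      then have "(\<rho>2 / n\<^sup>2) * (\<tau> \<bullet> (\<Sigma> *v v))\<^sup>2 \<le> (\<rho>2 / n\<^sup>2) * (n\<^sup>2 * (v \<bullet> (\<Sigma> *v v)))"
        using \<rho> by (intro mult_left_mono) auto
      then show ?thesis
        using \<rho> np by (simp add: e_def psd_inner_commute[OF S(1)] power_mult_distrib power_divide)
    qed
    \<comment> \<open>The strict \<open>z < y\<close> drops the lower atom below
      \<open>\<xi>\<close>, so at most the upper atom, of mass \<open>1 - p\<close>, counts.\<close>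
    have approx: "\<exists>F\<in>ambiguity_set \<mu> \<Sigma> \<rho>1 \<rho>2. measure F {r \<in> space F. \<tau> \<bullet> r \<ge> \<xi>} \<le> y\<^sup>2 / (1 + y\<^sup>2)"
      if y: "z < y" for y
    proof -
      define p where "p = 1 / (1 + y\<^sup>2)"
      have yp: "0 < y" using y z0 by simp
      have p: "0 \<le> p" "p \<le> 1" "1 - p = y\<^sup>2 / (1 + y\<^sup>2)"
        using z1[of y] by (auto simp: p_def field_simps)
      \<comment> \<open>Low value \<open>- y\<close> with probability \<open>p\<close> and high value \<open>1 / y\<close>: the standardised
        law for which Cantelli's inequality at distance \<open>y\<close> is an equality.\<close>
      let ?F = "two_point_law p (m + (- y) *\<^sub>R e) (m + (1 / y) *\<^sub>R e)"
      have "?F \<in> ambiguity_set \<mu> \<Sigma> \<rho>1 \<rho>2"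
      proof (rule two_point_law_in_ambiguity_set(1)[OF p(1,2) S(1) _ _ m e])
        show "p * - y + (1 - p) * (1 / y) = 0"
          using yp by (simp add: p(3)) (simp add: p_def power2_eq_square)
        have "p * (- y)\<^sup>2 + (1 - p) * (1 / y)\<^sup>2 = y\<^sup>2 / (1 + y\<^sup>2) + 1 / (1 + y\<^sup>2)"
          using yp by (simp add: p(3) power_divide) (simp add: p_def)
        also have "\<dots> = 1" using z1[of y] by (simp add: add_divide_distrib[symmetric] add.commute)
        finally show "p * (- y)\<^sup>2 + (1 - p) * (1 / y)\<^sup>2 = 1" .
      qed
      moreover have "measure ?F {r \<in> space ?F. \<tau> \<bullet> r \<ge> \<xi>} \<le> y\<^sup>2 / (1 + y\<^sup>2)"
      proof -
        have "t < y * s" using y s_pos by (simp add: z_def field_simps)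
        then have low: "\<not> \<xi> \<le> \<tau> \<bullet> (m + (- y) *\<^sub>R e)"
          by (simp add: inner_diff_right te t_def)
        have sp: "{r \<in> space ?F. \<tau> \<bullet> r \<ge> \<xi>} = {r. \<xi> \<le> \<tau> \<bullet> r}" by simp
        have "measure ?F {r \<in> space ?F. \<tau> \<bullet> r \<ge> \<xi>} \<le> measure (measure_pmf (bernoulli_pmf p)) {False}"
          unfolding sp measure_two_point_law[OF half]
          using low by (intro measure_pmf.finite_measure_mono) (auto split: if_splits)
        then show ?thesis using p by (simp add: measure_pmf_single)
      qed
      ultimately show ?thesis by blast
    qed
    have "\<exists>F\<in>ambiguity_set \<mu> \<Sigma> \<rho>1 \<rho>2. measure F {r \<in> space F. \<tau> \<bullet> r \<ge> \<xi>} \<le> h + d" if "0 < d" for d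
    proof -
      have "((\<lambda>y. y\<^sup>2 / (1 + y\<^sup>2)) \<longlongrightarrow> h) (at_right z)"
        unfolding h_def using z1[of z] by (auto intro!: tendsto_eq_intros)
      then have "eventually (\<lambda>y. y\<^sup>2 / (1 + y\<^sup>2) < h + d) (at_right z)"
        by (rule order_tendstoD) (use that in simp)
      moreover have "eventually (\<lambda>y. z < y) (at_right z)" by (rule eventually_at_right_less)
      ultimately have "eventually (\<lambda>y. z < y \<and> y\<^sup>2 / (1 + y\<^sup>2) < h + d) (at_right z)"
        by eventually_elim simp
      then obtain y where "z < y" "y\<^sup>2 / (1 + y\<^sup>2) < h + d"
        using eventually_happens[of _ "at_right z"] by (auto simp: trivial_limit_at_right_real)
      then show ?thesis using approx[of y] by (meson less_imp_le order_trans)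
    qed
    moreover have "ereal (\<tau> \<bullet> \<mu>) - (sqrt_odds h * ereal (sqrt \<rho>2) + ereal (sqrt \<rho>1))
            * ereal (norm (matrix_sqrt \<Sigma> *v \<tau>)) \<ge> ereal \<xi>"
      unfolding chance_constraint_iff[OF h(1) less_imp_le[OF h(2)] \<rho>(2) norm_ge_zero]
      using h(2) con by (simp add: n_def)
    ultimately show ?thesis using h by (intro exI[of _ h]) simp
  qed
qed

subsection \<open>The joint chance constraint\<close>

text \<open>The joint event is a box, so independence factors its probability.\<close>

lemma measure_PiM_chance:
  fixes F :: "nat \<Rightarrow> (real ^ 'n) measure"
  assumes F: "\<And>k. k \<in> {1..K} \<Longrightarrow> prob_space (F k)" "\<And>k. k \<in> {1..K} \<Longrightarrow> sets (F k) = sets borel"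
  shows "measure (Pi\<^sub>M {1..K} F) {r \<in> space (Pi\<^sub>M {1..K} F). \<forall>k\<in>{1..K}. \<tau> \<bullet> r k \<ge> \<xi> k}
    = (\<Prod>k=1..K. measure (F k) {r \<in> space (F k). \<tau> \<bullet> r \<ge> \<xi> k})"
proof -
  \<comment> \<open>The product locale wants a probability measure at every index; a point mass
    fills those outside \<open>{1..K}\<close>.\<close>
  define G where "G = (\<lambda>k. if k \<in> {1..K} then F k else return borel 0)"
  have PG: "Pi\<^sub>M {1..K} F = Pi\<^sub>M {1..K} G" by (rule PiM_cong) (auto simp: G_def)
  have prob: "prob_space (G k)" for k using F(1) by (auto simp: G_def intro: prob_space_return)
  interpret finite_product_prob_space G "{1..K}"
    by (simp add: finite_product_prob_space_def product_prob_space_def product_prob_space_axioms_def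
        finite_product_sigma_finite_def finite_product_sigma_finite_axioms_def
        product_sigma_finite_def prob prob_space_imp_sigma_finite)
  have eq: "{r \<in> space (Pi\<^sub>M {1..K} G). \<forall>k\<in>{1..K}. \<tau> \<bullet> r k \<ge> \<xi> k}
      = (\<Pi>\<^sub>E k\<in>{1..K}. {r \<in> space (G k). \<tau> \<bullet> r \<ge> \<xi> k})"
    unfolding space_PiM PiE_def Pi_def by blast
  have meas: "{r \<in> space (G k). \<tau> \<bullet> r \<ge> \<xi> k} \<in> sets (G k)" if "k \<in> {1..K}" for k
  proof -
    have s: "sets (G k) = sets borel" using F(2) that by (simp add: G_def)
    show ?thesis unfolding s sets_eq_imp_space_eq[OF s] by measurable
  qed
  have "measure (Pi\<^sub>M {1..K} G) {r \<in> space (Pi\<^sub>M {1..K} G). \<forall>k\<in>{1..K}. \<tau> \<bullet> r k \<ge> \<xi> k}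
    = (\<Prod>k=1..K. measure (G k) {r \<in> space (G k). \<tau> \<bullet> r \<ge> \<xi> k})"
    unfolding eq by (rule prob_times) (rule meas)
  then show ?thesis unfolding PG by (simp add: G_def)
qed

text \<open>Continuity of a finite product as \<open>d\<close> decreases to \<open>0\<close>; it
  removes the slack left by infima that are only approached.\<close>

lemma prod_ge_of_prod_add_ge:
  fixes h :: "'a \<Rightarrow> real"
  assumes "\<And>d. 0 < d \<Longrightarrow> \<epsilon> \<le> (\<Prod>k\<in>A. h k + d)"
  shows "\<epsilon> \<le> (\<Prod>k\<in>A. h k)"
proof (rule tendsto_lowerbound)
  show "((\<lambda>d. \<Prod>k\<in>A. h k + d) \<longlongrightarrow> (\<Prod>k\<in>A. h k)) (at_right 0)"
    by (auto intro!: tendsto_eq_intros)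
  show "eventually (\<lambda>d. \<epsilon> \<le> (\<Prod>k\<in>A. h k + d)) (at_right 0)"
    using eventually_at_right_less[of "0::real"] by eventually_elim (rule assms)
qed simp

lemma joint_chance_ge:
  fixes \<Sigma> :: "nat \<Rightarrow> real ^ 'l ^ 'l"
  assumes S: "\<And>k. k \<le> K \<Longrightarrow> psd (\<Sigma> k)" "\<And>k. k \<le> K \<Longrightarrow> invertible (\<Sigma> k)"
  shows "ereal \<epsilon> \<le> (INF F\<in>joint_ambiguity_set K \<mu> \<Sigma> \<rho>1 \<rho>2.
        ereal (measure F {r \<in> space F. \<forall>k\<in>{1..K}. \<tau> \<bullet> r k \<ge> \<xi> k})) \<longleftrightarrow>
    (\<forall>F. (\<forall>k\<in>{1..K}. F k \<in> ambiguity_set (\<mu> k) (\<Sigma> k) (\<rho>1 k) (\<rho>2 k)) \<longrightarrow>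
      \<epsilon> \<le> (\<Prod>k=1..K. measure (F k) {r \<in> space (F k). \<tau> \<bullet> r \<ge> \<xi> k}))"
proof -
  have eq: "measure (Pi\<^sub>M {1..K} F) {r \<in> space (Pi\<^sub>M {1..K} F). \<forall>k\<in>{1..K}. \<tau> \<bullet> r k \<ge> \<xi> k}
      = (\<Prod>k=1..K. measure (F k) {r \<in> space (F k). \<tau> \<bullet> r \<ge> \<xi> k})"
    if F: "\<forall>k\<in>{1..K}. F k \<in> ambiguity_set (\<mu> k) (\<Sigma> k) (\<rho>1 k) (\<rho>2 k)" for F
  proof (rule measure_PiM_chance)
    fix k assume k: "k \<in> {1..K}"
    with F S ambiguity_setD(1,2)[of "F k" "\<mu> k" "\<Sigma> k" "\<rho>1 k" "\<rho>2 k"]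
    show "prob_space (F k)" "sets (F k) = sets borel" by auto
  qed
  have "ereal \<epsilon> \<le> (INF F\<in>joint_ambiguity_set K \<mu> \<Sigma> \<rho>1 \<rho>2.
        ereal (measure F {r \<in> space F. \<forall>k\<in>{1..K}. \<tau> \<bullet> r k \<ge> \<xi> k})) \<longleftrightarrow>
    (\<forall>F. (\<forall>k\<in>{1..K}. F k \<in> ambiguity_set (\<mu> k) (\<Sigma> k) (\<rho>1 k) (\<rho>2 k)) \<longrightarrow>
      \<epsilon> \<le> measure (Pi\<^sub>M {1..K} F) {r \<in> space (Pi\<^sub>M {1..K} F). \<forall>k\<in>{1..K}. \<tau> \<bullet> r k \<ge> \<xi> k})"
    unfolding le_INF_iff joint_ambiguity_set_def ereal_less_eq by blast
  also have "\<dots> \<longleftrightarrow> (\<forall>F. (\<forall>k\<in>{1..K}. F k \<in> ambiguity_set (\<mu> k) (\<Sigma> k) (\<rho>1 k) (\<rho>2 k)) \<longrightarrow>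
      \<epsilon> \<le> (\<Prod>k=1..K. measure (F k) {r \<in> space (F k). \<tau> \<bullet> r \<ge> \<xi> k}))"
    by (intro iff_allI imp_cong refl) (simp only: eq)
  finally show ?thesis .
qed

lemma reform_feasible_imp_dr_feasible:
  fixes \<Sigma> :: "nat \<Rightarrow> real ^ 'l ^ 'l"
  assumes S: "\<And>k. k \<le> K \<Longrightarrow> psd (\<Sigma> k)" "\<And>k. k \<le> K \<Longrightarrow> invertible (\<Sigma> k)"
    and \<rho>: "\<And>k. k \<le> K \<Longrightarrow> 0 \<le> \<rho>2 k"
    and R: "reform_feasible D K \<mu> \<Sigma> \<rho>1 \<rho>2 \<xi> \<epsilon> \<tau> h"
  shows "dr_feasible D K \<mu> \<Sigma> \<rho>1 \<rho>2 \<xi> \<epsilon> \<tau>"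
proof -
  have "\<epsilon> \<le> (\<Prod>k=1..K. measure (F k) {r \<in> space (F k). \<tau> \<bullet> r \<ge> \<xi> k})"
    if F: "\<forall>k\<in>{1..K}. F k \<in> ambiguity_set (\<mu> k) (\<Sigma> k) (\<rho>1 k) (\<rho>2 k)" for F
  proof -
    have "\<epsilon> \<le> (\<Prod>k=1..K. h k)" using R by (simp add: reform_feasible_def)
    also have "\<dots> \<le> (\<Prod>k=1..K. measure (F k) {r \<in> space (F k). \<tau> \<bullet> r \<ge> \<xi> k})"
    proof (intro prod_mono conjI)
      fix k assume k: "k \<in> {1..K}"
      then show "0 \<le> h k" using R by (simp add: reform_feasible_def)
      show "h k \<le> measure (F k) {r \<in> space (F k). \<tau> \<bullet> r \<ge> \<xi> k}"
        by (rule chance_constraint_sufficient[OF bspec[OF F k]])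
          (use k S \<rho> R in \<open>auto simp: reform_feasible_def\<close>)
    qed
    finally show ?thesis .
  qed
  then show ?thesis
    using R joint_chance_ge[where K=K and \<Sigma>=\<Sigma>, OF S]
    unfolding dr_feasible_def reform_feasible_def by blast
qed

text \<open>Marginals can be chosen separately, so all of them can be within \<open>d\<close> of
  their worst case at once; their product is still at least \<open>\<epsilon>\<close>, and
  \<open>d\<close> then tends to \<open>0\<close>.\<close>

lemma dr_feasible_imp_reform_feasible:
  fixes \<Sigma> :: "nat \<Rightarrow> real ^ 'l ^ 'l"
  assumes S: "\<And>k. k \<le> K \<Longrightarrow> psd (\<Sigma> k)" "\<And>k. k \<le> K \<Longrightarrow> invertible (\<Sigma> k)"
    and \<rho>: "\<And>k. k \<le> K \<Longrightarrow> 0 \<le> \<rho>1 k" "\<And>k. k \<le> K \<Longrightarrow> 0 \<le> \<rho>2 k"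
    and \<epsilon>: "0 < \<epsilon>" and R: "dr_feasible D K \<mu> \<Sigma> \<rho>1 \<rho>2 \<xi> \<epsilon> \<tau>"
  shows "\<exists>h. reform_feasible D K \<mu> \<Sigma> \<rho>1 \<rho>2 \<xi> \<epsilon> \<tau> h"
proof -
  let ?U = "\<lambda>k. ambiguity_set (\<mu> k) (\<Sigma> k) (\<rho>1 k) (\<rho>2 k)"
  let ?P = "\<lambda>k F. measure F {r \<in> space F. \<tau> \<bullet> r \<ge> \<xi> k}"
  let ?C = "\<lambda>k h. ereal (\<tau> \<bullet> \<mu> k) - (sqrt_odds h * ereal (sqrt (\<rho>2 k)) + ereal (sqrt (\<rho>1 k)))
            * ereal (norm (matrix_sqrt (\<Sigma> k) *v \<tau>)) \<ge> ereal (\<xi> k)"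
  have joint: "\<epsilon> \<le> (\<Prod>k=1..K. ?P k (F k))" if "\<forall>k\<in>{1..K}. F k \<in> ?U k" for F
    using R that joint_chance_ge[where K=K and \<Sigma>=\<Sigma>, OF S] unfolding dr_feasible_def by blast
  have "\<exists>F. F \<in> ?U k" if "k \<in> {1..K}" for k
    using ambiguity_set_nonempty[OF S(1) \<rho>, of k k k] that by auto
  then obtain F0 where F0: "\<And>k. k \<in> {1..K} \<Longrightarrow> F0 k \<in> ?U k" by metis
  \<comment> \<open>A zero marginal at \<open>k\<close>, completed by \<open>F0\<close> elsewhere,
    would make the product zero; this is where \<open>0 < \<epsilon>\<close> enters.\<close>
  have pos: "0 < ?P k F" if k: "k \<in> {1..K}" and F: "F \<in> ?U k" for k F
  proof (rule ccontr)
    assume "\<not> 0 < ?P k F"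
    then have "?P k F = 0" by (simp add: zero_less_measure_iff)
    then have "(\<Prod>j=1..K. ?P j ((F0(k := F)) j)) = 0"
      using k by (intro prod_zero) (auto intro!: bexI[of _ k])
    moreover have "\<epsilon> \<le> (\<Prod>j=1..K. ?P j ((F0(k := F)) j))"
      using F0 F by (intro joint) auto
    ultimately show False using \<epsilon> by linarith
  qed
  have "\<forall>k\<in>{1..K}. \<exists>h. 0 \<le> h \<and> h \<le> 1 \<and> ?C k h \<and> (\<forall>d>0. \<exists>F\<in>?U k. ?P k F \<le> h + d)"
    by (intro ballI chance_constraint_necessary) (use S \<rho> pos in \<open>auto simp del: One_nat_def\<close>)
  from bchoice[OF this] obtain h where
    h: "\<forall>k\<in>{1..K}. 0 \<le> h k \<and> h k \<le> 1 \<and> ?C k (h k) \<and> (\<forall>d>0. \<exists>F\<in>?U k. ?P k F \<le> h k + d)" ..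
  have "\<epsilon> \<le> (\<Prod>k=1..K. h k)"
  proof (rule prod_ge_of_prod_add_ge)
    fix d :: real assume d: "0 < d"
    have "\<forall>k\<in>{1..K}. \<exists>F. F \<in> ?U k \<and> ?P k F \<le> h k + d" using h d by blast
    from bchoice[OF this] obtain F where F: "\<forall>k\<in>{1..K}. F k \<in> ?U k \<and> ?P k (F k) \<le> h k + d" ..
    have "\<epsilon> \<le> (\<Prod>k=1..K. ?P k (F k))" using F by (intro joint) blast
    also have "\<dots> \<le> (\<Prod>k=1..K. h k + d)" using F by (intro prod_mono) simp
    finally show "\<epsilon> \<le> (\<Prod>k=1..K. h k + d)" .
  qed
  then have "reform_feasible D K \<mu> \<Sigma> \<rho>1 \<rho>2 \<xi> \<epsilon> \<tau> h"
    using h R unfolding reform_feasible_def dr_feasible_def by blast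
  then show ?thesis by blast
qed

section \<open>The worst-case objective and the equivalence\<close>

text \<open>Only the mean enters the objective, so the infimum is attained by the point law at the
  worst mean.\<close>

lemma dr_objective_eq:
  fixes \<Sigma> :: "nat \<Rightarrow> real ^ 'l ^ 'l"
  assumes S: "psd (\<Sigma> 0)" "invertible (\<Sigma> 0)" and \<rho>: "0 \<le> \<rho>1 0" "0 \<le> \<rho>2 0" and \<alpha>: "\<alpha> < 1"
  shows "dr_objective \<alpha> \<mu> \<Sigma> \<rho>1 \<rho>2 \<tau> = ereal (- reform_objective \<alpha> \<mu> \<Sigma> \<rho>1 \<tau>)"
proof -
  let ?U = "ambiguity_set (\<mu> 0) (\<Sigma> 0) (\<rho>1 0) (\<rho>2 0)"
  let ?a = "\<tau> \<bullet> \<mu> 0 - sqrt (\<rho>1 0) * norm (matrix_sqrt (\<Sigma> 0) *v \<tau>)"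
  have obj: "- reform_objective \<alpha> \<mu> \<Sigma> \<rho>1 \<tau> = 1 / (1 - \<alpha>) * ?a"
    unfolding reform_objective_def by (simp only: mult_minus_right[symmetric]) simp
  obtain m where m: "(m - \<mu> 0) \<bullet> (matrix_inv (\<Sigma> 0) *v (m - \<mu> 0)) \<le> \<rho>1 0" and tm: "\<tau> \<bullet> m = ?a"
    using exists_worst_mean[OF S \<rho>(1)] by metis
  let ?F = "two_point_law (1/2) m m"
  note F = point_law_in_ambiguity_set[OF S(1) \<rho>(2) m]
  have "dr_objective \<alpha> \<mu> \<Sigma> \<rho>1 \<rho>2 \<tau> = ereal (1 / (1 - \<alpha>) * ?a)"
    unfolding dr_objective_def
  proof (rule antisym)
    have "(\<integral>r. \<tau> \<bullet> r \<partial>?F) = ?a" using ambiguity_setD(5)[OF F(1) S, of \<tau>] F(2) tm by simp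
    then show "(INF F\<in>?U. ereal (1 / (1 - \<alpha>) * (\<integral>r. \<tau> \<bullet> r \<partial>F))) \<le> ereal (1 / (1 - \<alpha>) * ?a)"
      using F(1) by (intro INF_lower2[of ?F]) simp_all
    show "ereal (1 / (1 - \<alpha>) * ?a) \<le> (INF F\<in>?U. ereal (1 / (1 - \<alpha>) * (\<integral>r. \<tau> \<bullet> r \<partial>F)))"
    proof (rule INF_greatest)
      fix F assume "F \<in> ?U"
      note FD = ambiguity_setD(5,6)[OF this S, of \<tau>]
      show "ereal (1 / (1 - \<alpha>) * ?a) \<le> ereal (1 / (1 - \<alpha>) * (\<integral>r. \<tau> \<bullet> r \<partial>F))"
        unfolding FD(1) ereal_less_eq using \<alpha> FD(2) by (intro mult_left_mono) auto
    qed
  qed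
  then show ?thesis using obj by simp
qed

text \<open>The converse is stated for \<open>\<epsilon> > 0\<close>: at
  \<open>\<epsilon> = 0\<close> the chance constraint holds for every \<open>\<tau>\<close>, while
  even \<open>h k = 0\<close> still demands that the lowest mean of
  \<open>\<tau> \<bullet> r k\<close> reach \<open>\<xi> k\<close>.\<close>

theorem proposition3p1:
  fixes A :: "'s::finite \<Rightarrow> 'a set"
    and p :: "'s \<Rightarrow> 'a \<Rightarrow> 's pmf"
    and q :: "'s pmf"
    and \<alpha> \<epsilon> :: real
    and ix :: "'s \<times> 'a \<Rightarrow> 'l::finite"
    and K :: nat
    and \<mu> :: "nat \<Rightarrow> real ^ 'l"
    and \<Sigma> :: "nat \<Rightarrow> real ^ 'l ^ 'l"
    and \<rho>1 \<rho>2 \<xi> :: "nat \<Rightarrow> real"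
  assumes "\<And>s. finite (A s)"
    and "bij_betw ix (state_actions A) UNIV"
    and "0 \<le> \<alpha>" and "\<alpha> < 1"
    and "0 \<le> \<epsilon>" and "\<epsilon> \<le> 1"
    and "\<And>k. k \<le> K \<Longrightarrow> psd (\<Sigma> k)"
    and "\<And>k. k \<le> K \<Longrightarrow> invertible (\<Sigma> k)"
    and "\<And>k. k \<le> K \<Longrightarrow> 0 \<le> \<rho>1 k"
    and "\<And>k. k \<le> K \<Longrightarrow> 0 \<le> \<rho>2 k"
  defines "D \<equiv> occupation_set A p q \<alpha> ix"
  shows "(\<forall>\<tau>. ((\<exists>h. reform_feasible D K \<mu> \<Sigma> \<rho>1 \<rho>2 \<xi> \<epsilon> \<tau> h) \<longrightarrow>
                  dr_feasible D K \<mu> \<Sigma> \<rho>1 \<rho>2 \<xi> \<epsilon> \<tau>) \<and>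
              (\<epsilon> > 0 \<longrightarrow> dr_feasible D K \<mu> \<Sigma> \<rho>1 \<rho>2 \<xi> \<epsilon> \<tau> \<longrightarrow>
                  (\<exists>h. reform_feasible D K \<mu> \<Sigma> \<rho>1 \<rho>2 \<xi> \<epsilon> \<tau> h))) \<and>
         (\<forall>\<tau> h. reform_feasible D K \<mu> \<Sigma> \<rho>1 \<rho>2 \<xi> \<epsilon> \<tau> h \<longrightarrow>
              ereal (reform_objective \<alpha> \<mu> \<Sigma> \<rho>1 \<tau>) = - dr_objective \<alpha> \<mu> \<Sigma> \<rho>1 \<rho>2 \<tau>)"
proof (intro conjI allI impI)
  fix \<tau>
  assume "\<exists>h. reform_feasible D K \<mu> \<Sigma> \<rho>1 \<rho>2 \<xi> \<epsilon> \<tau> h"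
  then obtain h where "reform_feasible D K \<mu> \<Sigma> \<rho>1 \<rho>2 \<xi> \<epsilon> \<tau> h" ..
  with assms(7,8,10) show "dr_feasible D K \<mu> \<Sigma> \<rho>1 \<rho>2 \<xi> \<epsilon> \<tau>"
    by (rule reform_feasible_imp_dr_feasible)
next
  fix \<tau>
  assume "0 < \<epsilon>" "dr_feasible D K \<mu> \<Sigma> \<rho>1 \<rho>2 \<xi> \<epsilon> \<tau>"
  with assms(7-10) show "\<exists>h. reform_feasible D K \<mu> \<Sigma> \<rho>1 \<rho>2 \<xi> \<epsilon> \<tau> h"
    by (rule dr_feasible_imp_reform_feasible)
next
  fix \<tau> h
  show "ereal (reform_objective \<alpha> \<mu> \<Sigma> \<rho>1 \<tau>) = - dr_objective \<alpha> \<mu> \<Sigma> \<rho>1 \<rho>2 \<tau>"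
    using dr_objective_eq[of \<Sigma> \<rho>1 \<rho>2 \<alpha> \<mu> \<tau>] assms(4,7-10) by simp
qed

end
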